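(* Let $q$ be a prime power, let $m,n\ge 1$, and let $\mathcal{C}$ be an $\mathbb{F}_{q^m}$-linear subspace of $\mathbb{F}_{q^m}^n$. If $\mathcal{C}$ is rank-metric intersecting, then $\mathcal{C}$ is Hamming-metric intersecting.
   Context: Support: fix an $\mathbb{F}_q$-basis $\Gamma$ of $\mathbb{F}_{q^m}$. For $x=(x_1,\dots,x_n)\in\mathbb{F}_{q^m}^n$ let $\mathrm{Mat}_\Gamma(x)\in\mathbb{F}_q^{m\times n}$ be the matrix whose $j$-th column is the coordinate vector of $x_j$ in the basis $\Gamma$. The (rank) support $\sigma(x)\subseteq\mathbb{F}_q^n$ is the $\mathbb{F}_q$-row space of $\mathrm{Mat}_\Gamma(x)$; it is independent of $\Gamma$. The code $\mathcal{C}$ is rank-metric intersecting if $\sigma(c)\cap\sigma(c')\ne\{0\}$ for all $c,c'\in\mathcal{C}\setminus\{0\}$. It is Hamming-metric intersecting if for any two nonzero codewords $c,c'\in\mathcal{C}$ there is a coordinate $i$ with $c_i\neq 0$ and $c'_i\neq 0$. *)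

theory Defs
  imports "HOL-Analysis.Analysis" "HOL-Number_Theory.Prime_Powers"
begin

text \<open>
  The extension of $F_q$ by $F_{q^m}$ is given by two finite field types \<open>'f\<close> and \<open>'k\<close> together
  with a field embedding \<open>\<phi> :: 'f \<Rightarrow> 'k\<close>, through which \<open>'f\<close> acts on \<open>'k\<close>. The index types \<open>'m\<close> and
  \<open>'n\<close> have $m$ and $n$ elements; they are nonempty, so $m, n \ge 1$ holds automatically.
\<close>

definition field_embedding :: "('f::field \<Rightarrow> 'k::field) \<Rightarrow> bool" where
  "field_embedding \<phi> \<longleftrightarrow>
     \<phi> 1 = 1 \<and> (\<forall>a b. \<phi> (a + b) = \<phi> a + \<phi> b) \<and> (\<forall>a b. \<phi> (a * b) = \<phi> a * \<phi> b)"

definition ext_scale :: "('f::field \<Rightarrow> 'k::field) \<Rightarrow> 'f \<Rightarrow> 'k \<Rightarrow> 'k" where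
  "ext_scale \<phi> a x = \<phi> a * x"

lemma vector_space_ext_scale:
  assumes "field_embedding \<phi>"
  shows "vector_space (ext_scale \<phi>)"
  using assms by unfold_locales (auto simp: field_embedding_def ext_scale_def algebra_simps)

definition ext_basis :: "('f::field \<Rightarrow> 'k::field) \<Rightarrow> ('m::finite \<Rightarrow> 'k) \<Rightarrow> bool" where
  "ext_basis \<phi> \<Gamma> \<longleftrightarrow>
     inj \<Gamma> \<and> \<not> module.dependent (ext_scale \<phi>) (range \<Gamma>) \<and>
     module.span (ext_scale \<phi>) (range \<Gamma>) = UNIV"

definition coord_matrix ::
  "('f::field \<Rightarrow> 'k::field) \<Rightarrow> ('m::finite \<Rightarrow> 'k) \<Rightarrow> 'k ^ 'n \<Rightarrow> 'f ^ 'n ^ 'm" where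
  "coord_matrix \<phi> \<Gamma> x = (\<chi> i j. module.representation (ext_scale \<phi>) (range \<Gamma>) (x $ j) (\<Gamma> i))"

definition rank_support ::
  "('f::field \<Rightarrow> 'k::field) \<Rightarrow> ('m::finite \<Rightarrow> 'k) \<Rightarrow> 'k ^ 'n \<Rightarrow> ('f ^ 'n) set" where
  "rank_support \<phi> \<Gamma> x = vec.span (rows (coord_matrix \<phi> \<Gamma> x))"

definition rank_intersecting ::
  "('f::field \<Rightarrow> 'k::field) \<Rightarrow> ('m::finite \<Rightarrow> 'k) \<Rightarrow> ('k ^ 'n) set \<Rightarrow> bool" where
  "rank_intersecting \<phi> \<Gamma> C \<longleftrightarrow>
     (\<forall>c \<in> C - {0}. \<forall>c' \<in> C - {0}. rank_support \<phi> \<Gamma> c \<inter> rank_support \<phi> \<Gamma> c' \<noteq> {0})"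

definition hamming_intersecting :: "('k::field ^ 'n) set \<Rightarrow> bool" where
  "hamming_intersecting C \<longleftrightarrow>
     (\<forall>c \<in> C - {0}. \<forall>c' \<in> C - {0}. \<exists>i. c $ i \<noteq> 0 \<and> c' $ i \<noteq> 0)"

lemma coord_matrix_expansion:
  fixes \<Gamma> :: "'m::finite \<Rightarrow> 'k::field" and x :: "'k ^ 'n"
  assumes "field_embedding \<phi>" "ext_basis \<phi> \<Gamma>"
  shows "x $ j = (\<Sum>i\<in>UNIV. \<phi> (coord_matrix \<phi> \<Gamma> x $ i $ j) * \<Gamma> i)"
proof -
  interpret E: vector_space "ext_scale \<phi>"
    using assms(1) by (rule vector_space_ext_scale)
  have inj: "inj \<Gamma>" and ind: "E.independent (range \<Gamma>)" and span: "E.span (range \<Gamma>) = UNIV"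
    using assms(2) by (auto simp: ext_basis_def)
  have "x $ j = (\<Sum>b\<in>range \<Gamma>. ext_scale \<phi> (E.representation (range \<Gamma>) (x $ j) b) b)"
    by (rule E.sum_representation_eq[symmetric]) (auto simp: ind span)
  also have "\<dots> = (\<Sum>i\<in>UNIV. \<phi> (coord_matrix \<phi> \<Gamma> x $ i $ j) * \<Gamma> i)"
    by (subst sum.reindex[OF inj]) (simp add: coord_matrix_def ext_scale_def)
  finally show ?thesis .
qed

lemma rank_support_independent_of_basis:
  fixes \<Gamma> \<Delta> :: "'m::finite \<Rightarrow> 'k::field" and x :: "'k ^ 'n"
  assumes "field_embedding \<phi>" "ext_basis \<phi> \<Gamma>" "ext_basis \<phi> \<Delta>"
  shows "rank_support \<phi> \<Gamma> x = rank_support \<phi> \<Delta> x"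
proof -
  interpret E: vector_space "ext_scale \<phi>"
    using assms(1) by (rule vector_space_ext_scale)
  have sub: "rank_support \<phi> B x \<subseteq> rank_support \<phi> A x"
    if A: "ext_basis \<phi> A" and B: "ext_basis \<phi> B" for A B :: "'m \<Rightarrow> 'k"
  proof -
    have ind: "E.independent (range B)" and span: "E.span (range B) = UNIV"
      using B by (auto simp: ext_basis_def)
    define P where "P = (\<lambda>i l. E.representation (range B) (A i) (B l))"
    have entry: "coord_matrix \<phi> B x $ l $ j = (\<Sum>i\<in>UNIV. P i l * coord_matrix \<phi> A x $ i $ j)"
      for l j
    proof -
      have "x $ j = (\<Sum>i\<in>UNIV. ext_scale \<phi> (coord_matrix \<phi> A x $ i $ j) (A i))"
        using coord_matrix_expansion[OF assms(1) A] by (simp add: ext_scale_def)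
      then have "coord_matrix \<phi> B x $ l $ j =
          E.representation (range B)
            (\<Sum>i\<in>UNIV. ext_scale \<phi> (coord_matrix \<phi> A x $ i $ j) (A i)) (B l)"
        by (simp add: coord_matrix_def[of \<phi> B])
      also have "\<dots> = (\<Sum>i\<in>UNIV. P i l * coord_matrix \<phi> A x $ i $ j)"
        by (simp add: E.representation_sum E.representation_scale ind span P_def mult.commute)
      finally show ?thesis .
    qed
    have row: "row l (coord_matrix \<phi> B x) = (\<Sum>i\<in>UNIV. P i l *s row i (coord_matrix \<phi> A x))" for l
      by (simp add: vec_eq_iff row_def entry)
    have "row i (coord_matrix \<phi> A x) \<in> vec.span (rows (coord_matrix \<phi> A x))" for i
      by (rule vec.span_base) (auto simp: rows_def)
    then have "row l (coord_matrix \<phi> B x) \<in> vec.span (rows (coord_matrix \<phi> A x))" for l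
      unfolding row by (intro vec.span_sum vec.span_scale)
    then have "rows (coord_matrix \<phi> B x) \<subseteq> vec.span (rows (coord_matrix \<phi> A x))"
      by (auto simp: rows_def[of "coord_matrix \<phi> B x"])
    then show ?thesis
      unfolding rank_support_def by (simp add: vec.span_minimal)
  qed
  show ?thesis
    using sub[OF assms(2,3)] sub[OF assms(3,2)] by blast
qed

end

theory Submission
  imports Defs
begin

text \<open>If \<open>c $ j = 0\<close>, then column j of the coordinate matrix is zero, so every
  combination of its rows vanishes at j (\<open>rank_support_nth_eq_0\<close>). Thus a vector in the
  rank support of c is nonzero only where c is. A nonzero v common to the rank supports of c and c'
  has some nonzero entry i, and there neither c nor c' can vanish.\<close>

lemma rank_support_nth_eq_0:
  fixes \<phi> :: "'f::field \<Rightarrow> 'k::field" and \<Gamma> :: "'m::finite \<Rightarrow> 'k" and x :: "'k ^ 'n"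
  assumes "field_embedding \<phi>" and "v \<in> rank_support \<phi> \<Gamma> x" and "x $ j = 0"
  shows "v $ j = 0"
proof -
  interpret E: vector_space "ext_scale \<phi>"
    using assms(1) by (rule vector_space_ext_scale)
  have "vec.subspace {w :: 'f ^ 'n. w $ j = 0}"
    by (rule vec.subspaceI) auto
  \<comment> \<open>Entry j of each row is a coordinate of \<open>x $ j = 0\<close>, hence 0; the
    hyperplane thus contains the span of the rows.\<close>
  moreover have "rows (coord_matrix \<phi> \<Gamma> x) \<subseteq> {w. w $ j = 0}"
    by (auto simp: rows_def row_def coord_matrix_def assms(3) E.representation_zero)
  ultimately show ?thesis
    using assms(2) vec.span_minimal unfolding rank_support_def by blast
qed

theorem proposition2p3:
  fixes q :: nat
    and \<phi> :: "'f::{field,finite} \<Rightarrow> 'k::{field,finite}"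
    and \<Gamma> :: "'m::finite \<Rightarrow> 'k"
    and C :: "('k ^ 'n) set"
  assumes "primepow q"
    and "CARD('f) = q"
    and "CARD('k) = q ^ CARD('m)"
    and "field_embedding \<phi>"
    and "ext_basis \<phi> \<Gamma>"
    and "vec.subspace C"
    and "rank_intersecting \<phi> \<Gamma> C"
  shows "hamming_intersecting C"
  unfolding hamming_intersecting_def
proof (intro ballI)
  fix c c' assume "c \<in> C - {0}" "c' \<in> C - {0}"
  then have "rank_support \<phi> \<Gamma> c \<inter> rank_support \<phi> \<Gamma> c' \<noteq> {0}"
    using assms(7) unfolding rank_intersecting_def by blast
  \<comment> \<open>Differing from \<open>{0}\<close> could also mean being empty; membership of 0
    excludes this and so yields a nonzero common vector.\<close>
  moreover have "0 \<in> rank_support \<phi> \<Gamma> c \<inter> rank_support \<phi> \<Gamma> c'"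
    by (simp add: rank_support_def vec.span_zero)
  ultimately obtain v where v: "v \<in> rank_support \<phi> \<Gamma> c" "v \<in> rank_support \<phi> \<Gamma> c'" "v \<noteq> 0"
    by blast
  then obtain i where "v $ i \<noteq> 0"
    by (auto simp: vec_eq_iff)
  then show "\<exists>i. c $ i \<noteq> 0 \<and> c' $ i \<noteq> 0"
    using rank_support_nth_eq_0[OF assms(4)] v by blast
qed

end
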